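(* Let $M$ and $N$ be two loopless matroids on the same finite ground set $E$, and let $\varphi:E\to E$ be a bijection inducing a rank-preserving weak map $M\to N$. Then, for every integer $m\geq 0$, $$(-1)^m[s^m]Z^{\mathrm{top}}_N(s)\ \geq\ (-1)^m[s^m]Z^{\mathrm{top}}_M(s),$$ where $[s^m]$ denotes the coefficient of $s^m$ in the power series expansion at $s=0$.
   Context: A bijection $\varphi:E\to E$ induces a (rank-preserving) weak map $M\to N$ between two matroids on $E$ if, for every basis $B$ of $N$, the set $\varphi^{-1}(B)=\{\varphi^{-1}(e)\mid e\in B\}$ is a basis of $M$. For a loopless matroid $M$ on a finite ground set $E$, $\mathcal{L}(M)$ is its lattice of flats (with bottom $\varnothing$ and top $E$), $\mu_{F,G}$ is the Möbius function of $\mathcal{L}(M)$, and for a flat $F$, $M|_F$ and $M/F$ denote restriction to and contraction by $F$ (both are loopless). The characteristic polynomial is $\chi_M(x)=\sum_{F\in\mathcal{L}(M)}\mu_{\varnothing,F}\,x^{\mathrm{rk}(M)-\mathrm{rk}_M(F)}$, and for $\mathrm{rk}(M)>0$ the reduced characteristic polynomial is $\overline{\chi}_M(x)=\chi_M(x)/(x-1)$. The topological zeta function $Z^{\mathrm{top}}_M(s)\in\mathbb{Q}(s)$ is defined for all loopless matroids recursively as follows. If $\mathrm{rk}(M)=0$, then $Z^{\mathrm{top}}_M(s)=1$. If $\mathrm{rk}(M)=r>0$ and $|E|=n$, then $$Z^{\mathrm{top}}_M(s)=\frac{1}{ns+r}\sum_{F\in\mathcal{L}(M),\ F\neq E}Z^{\mathrm{top}}_{M|_F}(s)\,\overline{\chi}_{M/F}(1).$$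 This rational function has no pole at $s=0$, so it has a power series expansion at $s=0$. *)

theory Defs
  imports Complex_Main
    "HOL-Computational_Algebra.Computational_Algebra"
    "HOL-Computational_Algebra.Field_as_Ring"
begin

record 'a indep_system =
  ground :: "'a set"
  indeps :: "'a set set"

locale matroid =
  fixes M :: "'a indep_system"
  assumes finite_ground: "finite (ground M)"
    and indep_subset_ground: "I \<in> indeps M \<Longrightarrow> I \<subseteq> ground M"
    and empty_indep: "{} \<in> indeps M"
    and hereditary: "I \<in> indeps M \<Longrightarrow> J \<subseteq> I \<Longrightarrow> J \<in> indeps M"
    and augmentation: "I \<in> indeps M \<Longrightarrow> J \<in> indeps M \<Longrightarrow> card I < card J
      \<Longrightarrow> \<exists>e\<in>J - I. insert e I \<in> indeps M"

definition loopless :: "'a indep_system \<Rightarrow> bool" where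
  "loopless M \<longleftrightarrow> (\<forall>e\<in>ground M. {e} \<in> indeps M)"

definition basis :: "'a indep_system \<Rightarrow> 'a set \<Rightarrow> bool" where
  "basis M B \<longleftrightarrow> B \<in> indeps M \<and> (\<forall>I\<in>indeps M. B \<subseteq> I \<longrightarrow> I = B)"

definition rk :: "'a indep_system \<Rightarrow> 'a set \<Rightarrow> nat" where
  "rk M A = Max (card ` {I \<in> indeps M. I \<subseteq> A})"

definition flats :: "'a indep_system \<Rightarrow> 'a set set" where
  "flats M = {F. F \<subseteq> ground M \<and> (\<forall>e\<in>ground M - F. rk M F < rk M (insert e F))}"

definition restriction :: "'a indep_system \<Rightarrow> 'a set \<Rightarrow> 'a indep_system" where
  "restriction M F = \<lparr>ground = F, indeps = {I \<in> indeps M. I \<subseteq> F}\<rparr>"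

definition contraction :: "'a indep_system \<Rightarrow> 'a set \<Rightarrow> 'a indep_system" where
  "contraction M F = \<lparr>ground = ground M - F,
     indeps = {I. I \<subseteq> ground M - F \<and> (\<exists>B. basis (restriction M F) B \<and> I \<union> B \<in> indeps M)}\<rparr>"

text \<open>Mapping bases to bases makes the ranks of \<open>M\<close> and \<open>N\<close> equal, so
  rank preservation needs no separate clause.\<close>

definition induces_weak_map ::
    "('a \<Rightarrow> 'a) \<Rightarrow> 'a indep_system \<Rightarrow> 'a indep_system \<Rightarrow> bool" where
  "induces_weak_map \<phi> M N \<longleftrightarrow> bij_betw \<phi> (ground M) (ground N) \<and>
     (\<forall>B. basis N B \<longrightarrow> basis M (inv_into (ground M) \<phi> ` B))"

text \<open>The Moebius function of the finite poset \<open>P\<close>, with the order of the ambient type.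
  It vanishes unless \<open>x \<le> y\<close>, the sum being empty otherwise.\<close>

function moebius :: "'b::order set \<Rightarrow> 'b \<Rightarrow> 'b \<Rightarrow> int" where
  "moebius P x y =
     (if infinite P then 0
      else if x = y then 1
      else - (\<Sum>z\<in>{z \<in> P. x \<le> z \<and> z < y}. moebius P x z))"
  by auto
termination
proof (relation "measure (\<lambda>(P, x, y). card {z \<in> P. z < y})")
  fix P :: "'b::order set" and x y z
  assume "\<not> infinite P" and z: "z \<in> {z \<in> P. x \<le> z \<and> z < y}"
  then have "finite {z \<in> P. z < y}" by simp
  moreover have "{w \<in> P. w < z} \<subset> {w \<in> P. w < y}" using z by force
  ultimately show "((P, x, z), (P, x, y)) \<in> measure (\<lambda>(P, x, y). card {z \<in> P. z < y})"
    by (simp add: psubset_card_mono)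
qed simp

declare moebius.simps [simp del]

definition characteristic_poly :: "'a indep_system \<Rightarrow> int poly" where
  "characteristic_poly M =
     (\<Sum>F\<in>flats M. monom (moebius (flats M) {} F) (rk M (ground M) - rk M F))"

definition reduced_characteristic_poly :: "'a indep_system \<Rightarrow> int poly" where
  "reduced_characteristic_poly M = characteristic_poly M div [:-1, 1:]"

lemma (in matroid) reduced_characteristic_poly_exact:
  assumes "rk M (ground M) > 0"
  shows "reduced_characteristic_poly M * [:-1, 1:] = characteristic_poly M"
proof -
  have "{I \<in> indeps M. I \<subseteq> {}} = {{}}" using empty_indep by auto
  then have rk0: "rk M {} = 0" by (simp add: rk_def)
  have top: "ground M \<in> flats M" by (simp add: flats_def)
  have ne: "{} \<noteq> ground M" using assms rk0 by auto
  have finF: "finite (flats M)" using finite_ground by (auto simp: flats_def)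
  have "flats M - {ground M} = {z \<in> flats M. {} \<subseteq> z \<and> z \<subset> ground M}"
    by (auto simp: flats_def)
  then have "moebius (flats M) {} (ground M) =
      - (\<Sum>F\<in>flats M - {ground M}. moebius (flats M) {} F)"
    using ne finF by (subst moebius.simps) simp
  then have "poly (characteristic_poly M) 1 = 0"
    using sum.remove[OF finF top, of "moebius (flats M) {}"]
    by (simp add: characteristic_poly_def poly_sum poly_monom)
  then have "[:-1, 1:] dvd characteristic_poly M" by (simp add: poly_eq_0_iff_dvd)
  then show ?thesis unfolding reduced_characteristic_poly_def by (rule dvd_div_mult_self)
qed

text \<open>Only the values on loopless matroids matter; the first branch makes the recursion
  terminate on arbitrary arguments.\<close>

function top_zeta :: "'a indep_system \<Rightarrow> rat poly fract" where
  "top_zeta M =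
     (if infinite (ground M) then 0
      else if rk M (ground M) = 0 then 1
      else 1 / to_fract [:of_nat (rk M (ground M)), of_nat (card (ground M)):] *
        (\<Sum>F\<in>flats M - {ground M}. top_zeta (restriction M F) *
           of_int (poly (reduced_characteristic_poly (contraction M F)) 1)))"
  by auto
termination
proof (relation "measure (\<lambda>M. card (ground M))")
  fix M :: "'a indep_system" and F
  assume "\<not> infinite (ground M)" and "F \<in> flats M - {ground M}"
  then show "(restriction M F, M) \<in> measure (\<lambda>M. card (ground M))"
    by (auto simp: flats_def restriction_def intro!: psubset_card_mono)
qed simp

declare top_zeta.simps [simp del]

text \<open>The power series expansion at \<open>0\<close> of a rational function without pole there:
  \<open>quot_of_fract\<close> returns numerator and denominator in lowest terms.\<close>

definition fps_of_ratfun :: "rat poly fract \<Rightarrow> rat fps" where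
  "fps_of_ratfun f = (case quot_of_fract f of (p, q) \<Rightarrow> fps_of_poly p / fps_of_poly q)"

lemma fps_of_ratfun_Fract:
  assumes "coeff q 0 \<noteq> 0"
  shows "fps_of_ratfun (Fract p q) = fps_of_poly p / fps_of_poly q"
proof -
  obtain a b where ab: "quot_of_fract (Fract p q) = (a, b)" by fastforce
  have b: "b \<noteq> 0" using snd_quot_of_fract_nonzero[of "Fract p q"] ab by simp
  have q: "q \<noteq> 0" using assms by auto
  have "Fract a b = Fract p q" using Fract_quot_of_fract[of "Fract p q"] ab by simp
  then have eq: "a * q = p * b" using b q by (simp add: eq_fract)
  have "coprime a b" using coprime_quot_of_fract[of "Fract p q"] ab by simp
  moreover have "b dvd a * q" using eq by simp
  ultimately have "b dvd q" by (simp add: coprime_commute coprime_dvd_mult_right_iff)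
  then obtain c where c: "q = b * c" ..
  then have p: "p = a * c" using eq b by (simp add: algebra_simps)
  have "coeff c 0 \<noteq> 0" using assms c by (simp add: coeff_mult_0)
  then have "fps_of_poly c \<noteq> 0" by (metis fps_of_poly_nth fps_zero_nth)
  then show ?thesis
    unfolding fps_of_ratfun_def ab prod.case by (simp add: p c fps_of_poly_mult)
qed

lemma top_zeta_no_pole: "\<exists>p q. coeff q 0 \<noteq> 0 \<and> top_zeta M = Fract p q"
proof -
  define R where "R = {Fract p q |p q :: rat poly. coeff q 0 \<noteq> 0}"
  have const: "to_fract p \<in> R" for p
    unfolding R_def to_fract_def by (intro CollectI exI[of _ p] exI[of _ 1]) simp
  have add: "x + y \<in> R" if "x \<in> R" "y \<in> R" for x y
  proof -
    from that obtain a b c d where *: "x = Fract a b" "y = Fract c d" "coeff b 0 \<noteq> 0" "coeff d 0 \<noteq> 0"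
      by (auto simp: R_def)
    then have "b \<noteq> 0" "d \<noteq> 0" by auto
    with * have "x + y = Fract (a * d + c * b) (b * d)" "coeff (b * d) 0 \<noteq> 0"
      by (auto simp: coeff_mult_0)
    then show ?thesis unfolding R_def by blast
  qed
  have mult: "x * y \<in> R" if "x \<in> R" "y \<in> R" for x y
  proof -
    from that obtain a b c d where *: "x = Fract a b" "y = Fract c d" "coeff b 0 \<noteq> 0" "coeff d 0 \<noteq> 0"
      by (auto simp: R_def)
    then have "x * y = Fract (a * c) (b * d)" "coeff (b * d) 0 \<noteq> 0"
      by (auto simp: coeff_mult_0)
    then show ?thesis unfolding R_def by blast
  qed
  have zero: "0 \<in> R" and one: "1 \<in> R" using const[of 0] const[of 1] by simp_all
  have sum: "sum f A \<in> R" if "\<And>x. x \<in> A \<Longrightarrow> f x \<in> R" for f and A :: "'a set set"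
    using that by (induction A rule: infinite_finite_induct) (auto simp: zero add)
  have int: "of_int k \<in> R" for k
  proof -
    have nat: "of_nat j \<in> R" for j
      using const[of "of_nat j"] by (simp add: to_fract_def Fract_of_nat_eq)
    have "- 1 \<in> R" using const[of "- 1"] by simp
    then have "- 1 * of_nat j \<in> R" for j by (intro mult nat)
    with nat show ?thesis by (cases k rule: int_cases2) simp_all
  qed
  have inv: "1 / to_fract [:of_nat r, c:] \<in> R" if "r \<noteq> 0" for r c
    unfolding R_def using that
    by (intro CollectI exI[of _ 1] exI[of _ "[:of_nat r, c:]"]) (simp add: to_fract_def One_fract_def)
  have "top_zeta M \<in> R"
  proof (induction M rule: top_zeta.induct)
    case (1 M)
    then show ?case
      by (subst top_zeta.simps) (auto intro!: mult sum inv int simp: zero one simp del: times_divide_eq_left)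
  qed
  then show ?thesis by (auto simp: R_def)
qed

end

theory Submission
  imports Defs
begin

text \<open>The coefficients have the closed form
  \[ (-1)^m [s^m] Z_M = \sum_{(e_1,\dots,e_m) \in E^m} \prod_{i=1}^m \frac{1}{\mathrm{rk}_M\{e_1,\dots,e_i\}}, \]
  and a weak map can only lower ranks, so the inequality holds summand by summand. To see that the
  closed form satisfies the defining recursion, put \<open>r = rk M\<close> and \<open>n = card E\<close>. Since the reduced characteristic
  polynomial at 1 is the derivative of the characteristic polynomial at 1, Moebius inversion shows
  that its values at \<open>M/F\<close>, summed over the proper flats \<open>F\<close> containing a set \<open>S\<close>, give
  \<open>r - rk S\<close>. The recursion then reduces to the identity
  \<open>\<Sum>\<^sub>x rk(x) w(x) = n \<Sum>\<^sub>y w(y)\<close> for the weights \<open>w\<close> of the sequences \<open>x\<close> of length \<open>m\<close>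
  and \<open>y\<close> of length \<open>m - 1\<close>, which holds because appending an entry to \<open>y\<close> divides
  the weight by the rank of the result.\<close>

section \<open>Moebius functions of finite posets\<close>

lemma sum_moebius_lower:
  assumes "finite P" "x \<in> P" "y \<in> P" "x \<le> y"
  shows "(\<Sum>z\<in>{z \<in> P. x \<le> z \<and> z \<le> y}. moebius P x z) = (if x = y then 1 else 0)"
proof (cases "x = y")
  case True
  then have "{z \<in> P. x \<le> z \<and> z \<le> y} = {x}" using assms by auto
  then show ?thesis using True assms(1) by (simp add: moebius.simps[of P y y])
next
  case False
  have "{z \<in> P. x \<le> z \<and> z \<le> y} = insert y {z \<in> P. x \<le> z \<and> z < y}" using assms by auto
  then show ?thesis using False assms(1) by (simp add: moebius.simps[of P x y])
qed

text \<open>The recursion makes \<open>moebius\<close> a one-sided inverse of the zeta function in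
  the incidence algebra; this is the other side. Summing \<open>moebius P z w\<close> over all pairs
  z \<le> w in the interval gives 1 by \<open>sum_moebius_lower\<close>. By induction the inner sums
  for w < y are known, which forces the one for y.\<close>

lemma sum_moebius_upper:
  assumes "finite P" "x \<in> P" "y \<in> P" "x \<le> y"
  shows "(\<Sum>z\<in>{z \<in> P. x \<le> z \<and> z \<le> y}. moebius P z y) = (if x = y then 1 else 0)"
  using assms(3,4)
proof (induction "card {z \<in> P. z < y}" arbitrary: y rule: less_induct)
  case less
  define f where "f w = (\<Sum>z\<in>{z \<in> P. x \<le> z \<and> z \<le> w}. moebius P z w)" for w
  define I where "I = {w \<in> P. x \<le> w \<and> w \<le> y}"
  have [simp]: "finite I" using assms(1) by (simp add: I_def)
  have yI: "y \<in> I" and xI: "x \<in> I" using assms(2) less.prems by (auto simp: I_def)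
  have "(\<Sum>w\<in>I. f w) = (\<Sum>w\<in>I. \<Sum>z\<in>{z \<in> I. z \<le> w}. moebius P z w)"
    unfolding f_def by (intro sum.cong refl) (auto simp: I_def)
  also have "\<dots> = (\<Sum>z\<in>I. \<Sum>w\<in>{w \<in> I. z \<le> w}. moebius P z w)"
    by (intro sum.swap_restrict) auto
  also have "\<dots> = (\<Sum>z\<in>I. \<Sum>w\<in>{w \<in> P. z \<le> w \<and> w \<le> y}. moebius P z w)"
    by (intro sum.cong refl) (auto simp: I_def)
  also have "\<dots> = (\<Sum>z\<in>I. if z = y then 1 else 0)"
    by (intro sum.cong refl sum_moebius_lower) (use assms less.prems in \<open>auto simp: I_def\<close>)
  also have "\<dots> = 1" using yI by simp
  finally have total: "(\<Sum>w\<in>I. f w) = 1" .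
  have IH: "f w = (if x = w then 1 else 0)" if "w \<in> I - {y}" for w
    unfolding f_def
  proof (rule less.hyps)
    have "w < y" using that by (auto simp: I_def)
    then have "{z \<in> P. z < w} \<subset> {z \<in> P. z < y}" using that by (force simp: I_def)
    then show "card {z \<in> P. z < w} < card {z \<in> P. z < y}"
      using assms(1) by (simp add: psubset_card_mono)
  qed (use that in \<open>auto simp: I_def\<close>)
  have "sum f (I - {y}) = (\<Sum>w\<in>I - {y}. if x = w then 1 else 0)"
    using IH by (intro sum.cong) auto
  \<comment> \<open>The remaining sum is 1 if x < y, from the term w = x, and 0 if x = y, since then
    \<open>x\<close> has been removed.\<close>
  then have "f y + (\<Sum>w\<in>I - {y}. if x = w then 1 else 0) = 1"
    using total sum.remove[OF \<open>finite I\<close> yI, of f] by simp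
  then show ?case using xI by (auto simp: f_def sum.delta)
qed

text \<open>The recursion for \<open>moebius P x y\<close> visits only elements above
  \<open>x\<close>, so an order embedding of that up-set suffices. The intended \<open>h\<close>
  removes a flat \<open>F\<close> from the flats containing it, which yields the flats of the
  contraction.\<close>

lemma moebius_image:
  fixes h :: "'b::order \<Rightarrow> 'c::order"
  assumes "finite P"
    and h: "\<And>a b. a \<in> P \<Longrightarrow> b \<in> P \<Longrightarrow> x \<le> a \<Longrightarrow> x \<le> b \<Longrightarrow> h a \<le> h b \<longleftrightarrow> a \<le> b"
    and "x \<in> P" "y \<in> P" "x \<le> y"
  shows "moebius (h ` {z \<in> P. x \<le> z}) (h x) (h y) = moebius P x y"
  using assms(4,5)
proof (induction "card {z \<in> P. z < y}" arbitrary: y rule: less_induct)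
  case less
  define Q where "Q = h ` {z \<in> P. x \<le> z}"
  have "finite Q" using assms(1) by (simp add: Q_def)
  have eq: "h a = h b \<longleftrightarrow> a = b" if "a \<in> P" "b \<in> P" "x \<le> a" "x \<le> b" for a b
    using h[of a b] h[of b a] that by (auto intro: antisym)
  have lt: "h a < h b \<longleftrightarrow> a < b" if "a \<in> P" "b \<in> P" "x \<le> a" "x \<le> b" for a b
    using h[of a b] eq[of a b] that by (simp add: less_le)
  show ?case
  proof (cases "x = y")
    case True
    then show ?thesis using \<open>finite Q\<close> assms(1) by (simp add: moebius.simps flip: Q_def)
  next
    case False
    have "{w \<in> Q. h x \<le> w \<and> w < h y} = h ` {z \<in> P. x \<le> z \<and> z < y}"
      unfolding Q_def using h lt less.prems assms(3) by auto
    moreover have "inj_on h {z \<in> P. x \<le> z \<and> z < y}"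
      using eq by (auto intro!: inj_onI)
    ultimately have "(\<Sum>w\<in>{w \<in> Q. h x \<le> w \<and> w < h y}. moebius Q (h x) w)
        = (\<Sum>z\<in>{z \<in> P. x \<le> z \<and> z < y}. moebius Q (h x) (h z))"
      by (simp add: sum.reindex)
    also have "\<dots> = (\<Sum>z\<in>{z \<in> P. x \<le> z \<and> z < y}. moebius P x z)"
      unfolding Q_def
    proof (intro sum.cong refl less.hyps)
      fix w assume w: "w \<in> {z \<in> P. x \<le> z \<and> z < y}"
      then have "{z \<in> P. z < w} \<subset> {z \<in> P. z < y}" by force
      then show "card {z \<in> P. z < w} < card {z \<in> P. z < y}"
        using assms(1) by (simp add: psubset_card_mono)
    qed auto
    finally show ?thesis
      using False \<open>finite Q\<close> assms(1,3) eq less.prems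
      by (simp add: moebius.simps[of P x y] moebius.simps[of Q "h x" "h y"] flip: Q_def)
  qed
qed

section \<open>Rank, closure and minors of a matroid\<close>

context matroid
begin

lemma finite_indeps: "finite (indeps M)"
  using finite_ground indep_subset_ground by (meson Pow_iff finite_Pow_iff finite_subset subsetI)

lemma card_le_rk: "I \<in> indeps M \<Longrightarrow> I \<subseteq> A \<Longrightarrow> card I \<le> rk M A"
  unfolding rk_def using finite_indeps by (intro Max_ge) auto

lemma rk_witness:
  obtains I where "I \<in> indeps M" "I \<subseteq> A" "card I = rk M A"
proof -
  have "rk M A \<in> card ` {I \<in> indeps M. I \<subseteq> A}"
    unfolding rk_def using finite_indeps empty_indep by (intro Max_in) auto
  then show ?thesis using that by auto
qed

lemma finite_indep: "I \<in> indeps M \<Longrightarrow> finite I"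
  using finite_ground indep_subset_ground finite_subset by blast

lemma rk_mono: "A \<subseteq> B \<Longrightarrow> rk M A \<le> rk M B"
  by (metis card_le_rk order_trans rk_witness)

lemma rk_empty: "rk M {} = 0"
  by (metis card.empty rk_witness subset_empty)

lemma indep_extend:
  assumes "I \<in> indeps M" "I \<subseteq> A"
  obtains J where "J \<in> indeps M" "I \<subseteq> J" "J \<subseteq> A" "card J = rk M A"
proof -
  have "\<exists>J \<in> indeps M. I \<subseteq> J \<and> J \<subseteq> A \<and> card J = rk M A"
    using assms
  proof (induction "rk M A - card I" arbitrary: I rule: less_induct)
    case less
    show ?case
    proof (cases "card I = rk M A")
      case True
      then show ?thesis using less.prems by blast
    next
      case False
      then have lt: "card I < rk M A" using card_le_rk less.prems by (simp add: le_neq_implies_less)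
      obtain K where K: "K \<in> indeps M" "K \<subseteq> A" "card K = rk M A" by (rule rk_witness)
      obtain e where e: "e \<in> K - I" "insert e I \<in> indeps M"
        using augmentation less.prems K lt by metis
      then have "rk M A - card (insert e I) < rk M A - card I"
        using finite_indep[OF less.prems(1)] lt by simp
      then show ?thesis using less.hyps[of "insert e I"] e K less.prems by blast
    qed
  qed
  then show ?thesis using that by blast
qed

text \<open>\<open>C\<close> is the closure of \<open>S\<close>. The last clause replaces the flats
  containing an arbitrary set by those above a single lattice element, where Moebius inversion
  applies.\<close>

lemma flat_generated:
  assumes "S \<subseteq> ground M"
  obtains C where "C \<in> flats M" "S \<subseteq> C" "rk M C = rk M S"
    "\<And>F. F \<in> flats M \<Longrightarrow> S \<subseteq> F \<longleftrightarrow> C \<subseteq> F"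
proof -
  define C where "C = {e \<in> ground M. rk M (insert e S) = rk M S}"
  obtain I where I: "I \<in> indeps M" "I \<subseteq> S" "card I = rk M S" by (rule rk_witness)
  \<comment> \<open>\<open>I\<close> already has size \<open>rk M S\<close>, which adding an element
    of the closure to \<open>S\<close> does not raise.\<close>
  have notin: "insert e I \<notin> indeps M" if "e \<in> C" "e \<notin> I" for e
  proof
    assume "insert e I \<in> indeps M"
    then have "card (insert e I) \<le> rk M (insert e S)" using I by (intro card_le_rk) auto
    then show False using that I finite_indep[OF I(1)] by (simp add: C_def)
  qed
  have SC: "S \<subseteq> C" using assms by (auto simp: C_def insert_absorb)
  have rkC: "rk M C = rk M S"
  proof (rule antisym)
    show "rk M C \<le> rk M S"
    proof (rule ccontr)
      assume "\<not> rk M C \<le> rk M S"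
      then obtain J where J: "J \<in> indeps M" "J \<subseteq> C" "card I < card J"
        using I(3) by (metis not_le rk_witness)
      then show False using augmentation[OF I(1) J(1)] notin by auto
    qed
  qed (use SC in \<open>rule rk_mono\<close>)
  have "rk M C < rk M (insert e C)" if "e \<in> ground M - C" for e
  proof -
    have "rk M S < rk M (insert e S)"
      using that rk_mono[OF subset_insertI, of S e] by (auto simp: C_def)
    also have "\<dots> \<le> rk M (insert e C)" using SC by (intro rk_mono) auto
    finally show ?thesis by (simp add: rkC)
  qed
  then have flat: "C \<in> flats M" by (auto simp: flats_def C_def)
  have least: "C \<subseteq> F" if F: "F \<in> flats M" "S \<subseteq> F" for F
  proof
    fix e assume e: "e \<in> C"
    show "e \<in> F"
    proof (rule ccontr)
      assume "e \<notin> F"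
      obtain J where J: "J \<in> indeps M" "I \<subseteq> J" "J \<subseteq> F" "card J = rk M F"
        using indep_extend I F by (metis order_trans)
      have "card J < rk M (insert e F)" using F e \<open>e \<notin> F\<close> J by (auto simp: flats_def C_def)
      then obtain K where K: "K \<in> indeps M" "K \<subseteq> insert e F" "card J < card K"
        by (metis rk_witness)
      obtain x where x: "x \<in> K - J" "insert x J \<in> indeps M" using augmentation[OF J(1) K(1,3)] by auto
      \<comment> \<open>\<open>J\<close> is a maximum independent subset of \<open>F\<close>, so
        only an element outside \<open>F\<close> can augment it. Heredity then makes
        \<open>insert e I\<close> independent, against \<open>notin\<close>.\<close>
      have "x = e"
      proof (rule ccontr)
        assume "x \<noteq> e"
        then have "card (insert x J) \<le> rk M F" using x J K by (intro card_le_rk) auto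
        then show False using x J finite_indep[OF J(1)] by simp
      qed
      then have "insert e I \<in> indeps M" using x J hereditary[of "insert e J" "insert e I"] by auto
      then show False using notin e I F \<open>e \<notin> F\<close> by auto
    qed
  qed
  show ?thesis using flat SC rkC least that[of C] by blast
qed

lemma finite_flats: "finite (flats M)"
  using finite_ground by (auto simp: flats_def)

lemma ground_flat: "ground M \<in> flats M"
  by (simp add: flats_def)

lemma basis_restriction_card:
  assumes "basis (restriction M F) B"
  shows "B \<in> indeps M" "B \<subseteq> F" "card B = rk M F"
proof -
  show B: "B \<in> indeps M" "B \<subseteq> F" using assms by (auto simp: basis_def restriction_def)
  obtain J where "J \<in> indeps M" "B \<subseteq> J" "J \<subseteq> F" "card J = rk M F" using indep_extend[OF B] .
  then show "card B = rk M F" using assms by (auto simp: basis_def restriction_def)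
qed

lemma basis_restriction_intro:
  assumes "B \<in> indeps M" "B \<subseteq> F" "card B = rk M F"
  shows "basis (restriction M F) B"
proof -
  have "I = B" if "I \<in> indeps M" "I \<subseteq> F" "B \<subseteq> I" for I
    using that assms card_le_rk[of I F] card_seteq[of I B] finite_indep[of I] by simp
  then show ?thesis using assms by (simp add: basis_def restriction_def)
qed

lemma rk_restriction: "A \<subseteq> F \<Longrightarrow> rk (restriction M F) A = rk M A"
  unfolding rk_def restriction_def by (rule arg_cong[of _ _ "\<lambda>X. Max (card ` X)"]) auto

lemma matroid_restriction:
  assumes "F \<subseteq> ground M"
  shows "matroid (restriction M F)"
proof
  show "finite (ground (restriction M F))"
    using assms finite_ground finite_subset by (auto simp: restriction_def)
next
  fix I J assume "I \<in> indeps (restriction M F)" "J \<in> indeps (restriction M F)" "card I < card J"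
  then show "\<exists>e\<in>J - I. insert e I \<in> indeps (restriction M F)"
    using augmentation[of I J] by (auto simp: restriction_def)
qed (use hereditary empty_indep in \<open>auto simp: restriction_def\<close>)

text \<open>Upper bound: an independent set of the contraction together with its witnessing basis of
  \<open>F\<close> is a disjoint independent union inside \<open>A \<union> F\<close>. Lower bound:
  extend a basis \<open>B\<close> of \<open>F\<close> to a maximum independent subset of
  \<open>A \<union> F\<close> and remove \<open>B\<close> again.\<close>

lemma rk_contraction:
  assumes "A \<subseteq> ground M - F"
  shows "rk (contraction M F) A = rk M (A \<union> F) - rk M F"
proof -
  define X where "X = {I \<in> indeps (contraction M F). I \<subseteq> A}"
  have "finite X" unfolding X_def using assms finite_ground
    by (auto intro: finite_subset[of _ "Pow A"] finite_subset[of A])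
  have "card I \<le> rk M (A \<union> F) - rk M F" if "I \<in> X" for I
  proof -
    obtain B where B: "basis (restriction M F) B" "I \<union> B \<in> indeps M" "I \<subseteq> ground M - F" "I \<subseteq> A"
      using \<open>I \<in> X\<close> by (auto simp: X_def contraction_def)
    note B' = basis_restriction_card[OF B(1)]
    have fin: "finite I" "finite B" using finite_indep[OF B(2)] by auto
    have "I \<inter> B = {}" using B B' by auto
    then have "card I + card B = card (I \<union> B)" using fin by (simp add: card_Un_disjoint)
    also have "\<dots> \<le> rk M (A \<union> F)" using B B' by (intro card_le_rk) auto
    finally show ?thesis using B' by simp
  qed
  moreover have "\<exists>I\<in>X. card I = rk M (A \<union> F) - rk M F"
  proof -
    obtain B where B: "B \<in> indeps M" "B \<subseteq> F" "card B = rk M F" by (rule rk_witness)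
    obtain J where J: "J \<in> indeps M" "B \<subseteq> J" "J \<subseteq> A \<union> F" "card J = rk M (A \<union> F)"
      using indep_extend[OF B(1)] B(2) by (metis le_supI2)
    \<comment> \<open>\<open>B\<close> has maximum size within \<open>F\<close>, so the extension
      \<open>J\<close> adds only elements outside \<open>F\<close>.\<close>
    have "card (J \<inter> F) \<le> card B"
      using J B hereditary[of J "J \<inter> F"] by (auto intro!: card_le_rk)
    then have JF: "B = J \<inter> F" using B J finite_indep[OF J(1)] by (intro card_seteq) auto
    have "basis (restriction M F) B" using B by (rule basis_restriction_intro)
    moreover have "(J - B) \<union> B = J" using J by auto
    ultimately have "J - B \<in> X"
      using J JF indep_subset_ground[OF J(1)] unfolding X_def contraction_def by auto
    moreover have "card (J - B) = rk M (A \<union> F) - rk M F"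
      using J B finite_indep[OF B(1)] by (simp add: card_Diff_subset)
    ultimately show ?thesis by blast
  qed
  ultimately show ?thesis
    unfolding rk_def[of "contraction M F"] X_def[symmetric] using \<open>finite X\<close>
    by (intro Max_eqI) (auto, metis imageI)
qed

lemma flats_contraction:
  assumes "F \<subseteq> ground M"
  shows "flats (contraction M F) = (\<lambda>G. G - F) ` {G \<in> flats M. F \<subseteq> G}"
proof -
  have ground: "ground (contraction M F) = ground M - F" by (simp add: contraction_def)
  have iff: "H \<in> flats (contraction M F) \<longleftrightarrow> H \<union> F \<in> flats M" if H: "H \<subseteq> ground M - F" for H
  proof -
    have "rk (contraction M F) H < rk (contraction M F) (insert e H)
        \<longleftrightarrow> rk M (H \<union> F) < rk M (insert e (H \<union> F))" if "e \<in> ground M - F - H" for e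
    proof -
      have "rk (contraction M F) H = rk M (H \<union> F) - rk M F"
        "rk (contraction M F) (insert e H) = rk M (insert e (H \<union> F)) - rk M F"
        using H that by (simp_all add: rk_contraction)
      \<comment> \<open>Subtracting \<open>rk M F\<close> must not truncate, or the strict
        inequality would not carry over.\<close>
      moreover have "rk M F \<le> rk M (H \<union> F)" by (intro rk_mono) auto
      ultimately show ?thesis by linarith
    qed
    moreover have "ground M - (H \<union> F) = ground M - F - H" by auto
    ultimately show ?thesis using H assms unfolding flats_def ground by auto
  qed
  show ?thesis
  proof (intro equalityI subsetI)
    fix H assume H: "H \<in> flats (contraction M F)"
    then have sub: "H \<subseteq> ground M - F" unfolding flats_def ground by simp
    then have "H = (H \<union> F) - F" by auto
    then show "H \<in> (\<lambda>G. G - F) ` {G \<in> flats M. F \<subseteq> G}" using iff[OF sub] H by blast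
  next
    fix H assume "H \<in> (\<lambda>G. G - F) ` {G \<in> flats M. F \<subseteq> G}"
    then obtain G where G: "G \<in> flats M" "F \<subseteq> G" "H = G - F" by auto
    then have "H \<subseteq> ground M - F" "H \<union> F = G" by (auto simp: flats_def)
    then show "H \<in> flats (contraction M F)" using iff G by simp
  qed
qed

text \<open>\<open>moebius_image\<close> moves the Moebius values into the lattice of flats of
  \<open>M\<close>, and the shift by \<open>rk M F\<close> cancels in the exponents.\<close>

lemma characteristic_poly_contraction:
  assumes F: "F \<in> flats M"
  shows "characteristic_poly (contraction M F) =
    (\<Sum>G\<in>{G \<in> flats M. F \<subseteq> G}. monom (moebius (flats M) F G) (rk M (ground M) - rk M G))"
proof -
  define h where "h G = G - F" for G :: "'a set"
  have FE: "F \<subseteq> ground M" using F by (simp add: flats_def)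
  have inj: "inj_on h {G \<in> flats M. F \<subseteq> G}" by (auto simp: inj_on_def h_def)
  have flats: "flats (contraction M F) = h ` {G \<in> flats M. F \<subseteq> G}"
    using flats_contraction[OF FE] by (simp add: h_def)
  have mu: "moebius (flats (contraction M F)) {} (h G) = moebius (flats M) F G"
    if "G \<in> flats M" "F \<subseteq> G" for G
  proof -
    have "moebius (h ` {G \<in> flats M. F \<subseteq> G}) (h F) (h G) = moebius (flats M) F G"
      by (rule moebius_image) (use finite_flats F that in \<open>auto simp: h_def\<close>)
    then show ?thesis by (simp add: flats h_def)
  qed
  have rank: "rk (contraction M F) (h G) = rk M G - rk M F" if "G \<in> flats M" "F \<subseteq> G" for G
  proof -
    have "(G - F) \<union> F = G" using that by auto
    then show ?thesis using rk_contraction[of "G - F" F] that by (auto simp: h_def flats_def)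
  qed
  have "ground (contraction M F) = h (ground M)" by (simp add: contraction_def h_def)
  then have exponent: "rk (contraction M F) (ground (contraction M F)) - rk (contraction M F) (h G)
      = rk M (ground M) - rk M G" if "G \<in> flats M" "F \<subseteq> G" for G
    using that rank[OF that] rank[OF ground_flat FE] rk_mono[OF FE] rk_mono[of F G] by simp
  show ?thesis
    unfolding characteristic_poly_def
    by (subst (1) flats, subst sum.reindex[OF inj]) (auto intro!: sum.cong simp: mu exponent)
qed

section \<open>Reduced characteristic polynomials of contractions, evaluated at 1\<close>

lemma reduced_characteristic_poly_contraction_1:
  assumes F: "F \<in> flats M" "F \<noteq> ground M"
  shows "poly (reduced_characteristic_poly (contraction M F)) 1 =
    (\<Sum>G\<in>{G \<in> flats M. F \<subseteq> G}. moebius (flats M) F G * (int (rk M (ground M)) - int (rk M G)))"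
proof -
  define \<chi> where "\<chi> = characteristic_poly (contraction M F)"
  define \<rho> where "\<rho> = reduced_characteristic_poly (contraction M F)"
  have \<chi>: "\<chi> = (\<Sum>G\<in>{G \<in> flats M. F \<subseteq> G}. monom (moebius (flats M) F G) (rk M (ground M) - rk M G))"
    unfolding \<chi>_def by (rule characteristic_poly_contraction[OF F(1)])
  have "{G \<in> flats M. F \<subseteq> G} = {G \<in> flats M. F \<subseteq> G \<and> G \<subseteq> ground M}" by (auto simp: flats_def)
  moreover have "F \<subseteq> ground M" using F by (simp add: flats_def)
  ultimately have "poly \<chi> 1 = 0"
    using sum_moebius_lower[OF finite_flats F(1) ground_flat] F(2)
    by (simp add: \<chi> poly_sum poly_monom)
  then have "[:-1, 1:] dvd \<chi>" by (simp add: poly_eq_0_iff_dvd)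
  then have "\<chi> = \<rho> * [:-1, 1:]"
    unfolding \<rho>_def reduced_characteristic_poly_def \<chi>_def by (rule dvd_div_mult_self[symmetric])
  \<comment> \<open>Product rule: the term containing the derivative of \<open>\<rho>\<close>
    carries the factor x - 1 and vanishes at 1.\<close>
  then have "poly \<rho> 1 = poly (pderiv \<chi>) 1"
    by (simp only: pderiv_mult poly_add poly_mult) (simp add: pderiv_pCons)
  also have "\<dots> = (\<Sum>G\<in>{G \<in> flats M. F \<subseteq> G}.
      moebius (flats M) F G * int (rk M (ground M) - rk M G))"
    by (simp add: \<chi> higher_pderiv_sum[where n = 1, simplified] pderiv_monom poly_sum poly_monom mult.commute)
  also have "\<dots> = (\<Sum>G\<in>{G \<in> flats M. F \<subseteq> G}.
      moebius (flats M) F G * (int (rk M (ground M)) - int (rk M G)))"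
    by (intro sum.cong refl) (auto simp: flats_def rk_mono of_nat_diff)
  finally show ?thesis unfolding \<rho>_def .
qed

text \<open>With \<open>C\<close> the closure of \<open>S\<close>, exchanging the two sums leaves
  for each flat \<open>G\<close> the sum of the Moebius values from \<open>F\<close> to
  \<open>G\<close> over all \<open>F\<close> between \<open>C\<close> and \<open>G\<close>. By
  \<open>sum_moebius_upper\<close> only \<open>G = C\<close> survives.\<close>

lemma sum_reduced_characteristic_poly_contraction_1:
  assumes "S \<subseteq> ground M"
  shows "(\<Sum>F\<in>{F \<in> flats M - {ground M}. S \<subseteq> F}. poly (reduced_characteristic_poly (contraction M F)) 1)
    = int (rk M (ground M)) - int (rk M S)"
proof -
  define d where "d G = int (rk M (ground M)) - int (rk M G)" for G
  define \<mu> where "\<mu> = moebius (flats M)"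
  obtain C where C: "C \<in> flats M" "S \<subseteq> C" "rk M C = rk M S"
    and least: "\<And>F. F \<in> flats M \<Longrightarrow> S \<subseteq> F \<longleftrightarrow> C \<subseteq> F"
    using flat_generated[OF assms] by metis
  define U where "U = {F \<in> flats M. C \<subseteq> F}"
  have [simp]: "finite U" using finite_flats by (simp add: U_def)
  have E: "ground M \<in> U" using C by (auto simp: U_def flats_def)
  have "{F \<in> flats M - {ground M}. S \<subseteq> F} = U - {ground M}"
    using least by (auto simp: U_def)
  then have "(\<Sum>F\<in>{F \<in> flats M - {ground M}. S \<subseteq> F}. poly (reduced_characteristic_poly (contraction M F)) 1)
    = (\<Sum>F\<in>U - {ground M}. \<Sum>G\<in>{G \<in> flats M. F \<subseteq> G}. \<mu> F G * d G)"
    by (auto intro!: sum.cong simp: reduced_characteristic_poly_contraction_1 U_def d_def \<mu>_def)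
  \<comment> \<open>The full ground set may be added to the range of \<open>F\<close>: the only flat
    above it is itself, where \<open>d\<close> is 0. This completes the intervals needed for
    inversion.\<close>
  also have "\<dots> = (\<Sum>F\<in>U. \<Sum>G\<in>{G \<in> flats M. F \<subseteq> G}. \<mu> F G * d G)"
  proof -
    have "{G \<in> flats M. ground M \<subseteq> G} = {ground M}" by (auto simp: flats_def)
    then show ?thesis using E by (simp add: sum.remove[OF _ E] d_def)
  qed
  also have "\<dots> = (\<Sum>F\<in>U. \<Sum>G\<in>{G \<in> U. F \<subseteq> G}. \<mu> F G * d G)"
    by (intro sum.cong refl) (auto simp: U_def)
  also have "\<dots> = (\<Sum>G\<in>U. \<Sum>F\<in>{F \<in> U. F \<subseteq> G}. \<mu> F G * d G)"
    by (intro sum.swap_restrict) auto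
  also have "\<dots> = (\<Sum>G\<in>U. (\<Sum>F\<in>{F \<in> flats M. C \<subseteq> F \<and> F \<subseteq> G}. \<mu> F G) * d G)"
    unfolding sum_distrib_right by (intro sum.cong refl) (auto simp: U_def)
  also have "\<dots> = (\<Sum>G\<in>U. (if C = G then 1 else 0) * d G)"
    unfolding \<mu>_def
    by (intro sum.cong refl) (use sum_moebius_upper[OF finite_flats C(1)] in \<open>auto simp: U_def\<close>)
  also have "\<dots> = (\<Sum>G\<in>U. if C = G then d G else 0)" by (intro sum.cong) auto
  also have "\<dots> = d C"
  proof -
    have "C \<in> U" using C by (simp add: U_def)
    then show ?thesis by simp
  qed
  finally show ?thesis using C by (simp add: d_def)
qed

end

section \<open>Weights of sequences and their recursion\<close>

text \<open>Sequences are stored in reverse: the head of the list is the last entry.\<close>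

fun seq_weight :: "'a indep_system \<Rightarrow> 'a list \<Rightarrow> rat" where
  "seq_weight M [] = 1"
| "seq_weight M (e # es) = seq_weight M es / of_nat (rk M (set (e # es)))"

text \<open>\<open>F\<close> is kept separate from \<open>M\<close> so that the sum belonging to
  \<open>restriction M F\<close> can be written with weights of \<open>M\<close> itself, ready for
  exchanging it with the sum over flats.\<close>

definition weight_sum :: "'a indep_system \<Rightarrow> 'a set \<Rightarrow> nat \<Rightarrow> rat" where
  "weight_sum M F m = (\<Sum>es\<in>{es. set es \<subseteq> F \<and> length es = m}. seq_weight M es)"

lemma seq_weight_nonneg: "seq_weight M es \<ge> 0"
  by (induction es) auto

lemma weight_sum_0 [simp]: "weight_sum M F 0 = 1"
proof -
  have "{es. set es \<subseteq> F \<and> es = []} = {[]}" by auto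
  then show ?thesis by (simp add: weight_sum_def)
qed

lemma (in matroid) seq_weight_restriction:
  "set es \<subseteq> F \<Longrightarrow> seq_weight (restriction M F) es = seq_weight M es"
  by (induction es) (simp_all add: rk_restriction)

lemma (in matroid) weight_sum_restriction:
  "weight_sum (restriction M F) F m = weight_sum M F m"
  unfolding weight_sum_def by (intro sum.cong) (auto simp: seq_weight_restriction)

lemma (in matroid) rk_pos:
  assumes "loopless M" "e \<in> ground M" "e \<in> S"
  shows "rk M S > 0"
  using card_le_rk[of "{e}" S] assms by (auto simp: loopless_def)

text \<open>The factor \<open>rk M (set es)\<close> cancels the last division in the weight, so the
  last entry becomes a free choice among the elements of the ground set.\<close>

lemma (in matroid) weight_sum_rk_Suc:
  assumes "loopless M"
  shows "(\<Sum>es\<in>{es. set es \<subseteq> ground M \<and> length es = Suc m}. seq_weight M es * of_nat (rk M (set es)))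
    = of_nat (card (ground M)) * weight_sum M (ground M) m"
proof -
  let ?L = "\<lambda>m. {es. set es \<subseteq> ground M \<and> length es = m}"
  have "?L (Suc m) = (\<lambda>(e, es). e # es) ` (ground M \<times> ?L m)"
    by (auto simp: length_Suc_conv image_iff)
  moreover have "inj_on (\<lambda>(e, es). e # es) (ground M \<times> ?L m)" by (auto simp: inj_on_def)
  ultimately have "(\<Sum>es\<in>?L (Suc m). seq_weight M es * of_nat (rk M (set es)))
    = (\<Sum>(e, es)\<in>ground M \<times> ?L m. seq_weight M (e # es) * of_nat (rk M (set (e # es))))"
    by (simp add: sum.reindex case_prod_unfold)
  also have "\<dots> = (\<Sum>(e, es)\<in>ground M \<times> ?L m. seq_weight M es)"
  \<comment> \<open>Cancelling leaves the case of a zero denominator, which looplessness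
    excludes.\<close>
  proof (intro sum.cong refl, clarsimp)
    fix e es assume "e \<in> ground M" "rk M (insert e (set es)) = 0"
    then show "seq_weight M es = 0" using rk_pos[OF assms, of e "insert e (set es)"] by simp
  qed
  also have "\<dots> = of_nat (card (ground M)) * weight_sum M (ground M) m"
    by (simp add: weight_sum_def flip: sum.cartesian_product)
  finally show ?thesis .
qed

text \<open>After exchanging the sums, a sequence is counted once for each proper flat containing
  its entries, and \<open>sum_reduced_characteristic_poly_contraction_1\<close> evaluates the
  total.\<close>

lemma (in matroid) weight_sum_flats:
  "(\<Sum>F\<in>flats M - {ground M}.
      weight_sum M F m * of_int (poly (reduced_characteristic_poly (contraction M F)) 1))
   = (\<Sum>es\<in>{es. set es \<subseteq> ground M \<and> length es = m}.
      seq_weight M es * (of_nat (rk M (ground M)) - of_nat (rk M (set es))))"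
proof -
  define c where "c F = (of_int (poly (reduced_characteristic_poly (contraction M F)) 1) :: rat)" for F
  define L where "L = {es. set es \<subseteq> ground M \<and> length es = m}"
  have "finite L" unfolding L_def by (rule finite_lists_length_eq[OF finite_ground])
  have "(\<Sum>F\<in>flats M - {ground M}. weight_sum M F m * c F)
    = (\<Sum>F\<in>flats M - {ground M}. \<Sum>es\<in>{es \<in> L. set es \<subseteq> F}. seq_weight M es * c F)"
    unfolding weight_sum_def sum_distrib_right
    by (intro sum.cong refl) (auto simp: L_def flats_def)
  also have "\<dots> = (\<Sum>es\<in>L. \<Sum>F\<in>{F \<in> flats M - {ground M}. set es \<subseteq> F}. seq_weight M es * c F)"
    by (intro sum.swap_restrict) (use finite_flats \<open>finite L\<close> in auto)
  also have "\<dots> = (\<Sum>es\<in>L. seq_weight M es * (of_nat (rk M (ground M)) - of_nat (rk M (set es))))"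
  proof (intro sum.cong refl)
    fix es assume "es \<in> L"
    then have "(\<Sum>F\<in>{F \<in> flats M - {ground M}. set es \<subseteq> F}. c F)
      = of_int (int (rk M (ground M)) - int (rk M (set es)))"
      unfolding c_def of_int_sum[symmetric]
      by (subst sum_reduced_characteristic_poly_contraction_1) (auto simp: L_def)
    then show "(\<Sum>F\<in>{F \<in> flats M - {ground M}. set es \<subseteq> F}. seq_weight M es * c F)
      = seq_weight M es * (of_nat (rk M (ground M)) - of_nat (rk M (set es)))"
      by (simp flip: sum_distrib_left)
  qed
  finally show ?thesis unfolding c_def L_def .
qed

definition weight_fps :: "'a indep_system \<Rightarrow> rat fps" where
  "weight_fps M = Abs_fps (\<lambda>m. (-1) ^ m * weight_sum M (ground M) m)"

text \<open>Up to the sign (-1)^m, the left side has coefficient r w_m - n w_(m-1), where w_m is the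
  weight sum for length m. By \<open>weight_sum_flats\<close> the right side has r w_m minus the
  rank-weighted sum, and \<open>weight_sum_rk_Suc\<close> identifies the subtracted terms.\<close>

lemma (in matroid) weight_fps_recursion:
  assumes "loopless M"
  shows "fps_of_poly [:of_nat (rk M (ground M)), of_nat (card (ground M)):] * weight_fps M
    = (\<Sum>F\<in>flats M - {ground M}. weight_fps (restriction M F) *
        of_int (poly (reduced_characteristic_poly (contraction M F)) 1))"
proof (rule fps_ext)
  fix m
  let ?r = "of_nat (rk M (ground M)) :: rat" and ?n = "of_nat (card (ground M)) :: rat"
  let ?L = "{es. set es \<subseteq> ground M \<and> length es = m}"
  have "fps_nth (\<Sum>F\<in>flats M - {ground M}. weight_fps (restriction M F) *
        of_int (poly (reduced_characteristic_poly (contraction M F)) 1)) m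
    = (-1) ^ m * (\<Sum>F\<in>flats M - {ground M}.
      weight_sum M F m * of_int (poly (reduced_characteristic_poly (contraction M F)) 1))"
  proof -
    have "ground (restriction M F) = F" for F by (simp add: restriction_def)
    then show ?thesis
      by (simp add: weight_fps_def fps_sum_nth weight_sum_restriction sum_distrib_left mult.assoc
          flip: fps_of_int)
  qed
  also have "\<dots> = (-1) ^ m * (?r * weight_sum M (ground M) m
      - (\<Sum>es\<in>?L. seq_weight M es * of_nat (rk M (set es))))"
    unfolding weight_sum_flats
    by (simp add: weight_sum_def right_diff_distrib sum_subtractf sum_distrib_left mult.commute)
  also have "\<dots> = fps_nth (fps_of_poly [:?r, ?n:] * weight_fps M) m"
  proof (cases m)
    case 0
    \<comment> \<open>The empty sequence has rank 0, so nothing is subtracted, just as n does not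
      enter the constant coefficient.\<close>
    have "{es. set es \<subseteq> ground M \<and> es = []} = {[]}" by auto
    then show ?thesis using 0 by (simp add: weight_fps_def rk_empty)
  next
    case (Suc k)
    have "fps_of_poly [:?r, ?n:] * weight_fps M
      = fps_const ?r * weight_fps M + fps_X * (fps_const ?n * weight_fps M)"
      by (simp add: fps_of_poly_pCons algebra_simps)
    then have "fps_nth (fps_of_poly [:?r, ?n:] * weight_fps M) m
      = ?r * fps_nth (weight_fps M) m + ?n * fps_nth (weight_fps M) k"
      by (simp add: Suc)
    then show ?thesis
      using weight_sum_rk_Suc[OF assms, of k] by (simp add: Suc weight_fps_def algebra_simps)
  qed
  finally show "fps_nth (fps_of_poly [:?r, ?n:] * weight_fps M) m
    = fps_nth (\<Sum>F\<in>flats M - {ground M}. weight_fps (restriction M F) *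
        of_int (poly (reduced_characteristic_poly (contraction M F)) 1)) m" by simp
qed

section \<open>Power series expansions of rational functions and of the zeta function\<close>

text \<open>Any fraction with nonvanishing constant term in the denominator is allowed, not only the
  one in lowest terms, so that closure under ring operations is immediate. The series is still
  determined by \<open>f\<close>, as \<open>has_expansion_fps_of_ratfun\<close> shows.\<close>

definition has_expansion :: "rat poly fract \<Rightarrow> rat fps \<Rightarrow> bool" where
  "has_expansion f a \<longleftrightarrow>
     (\<exists>p q. coeff q 0 \<noteq> 0 \<and> f = Fract p q \<and> a * fps_of_poly q = fps_of_poly p)"

lemma has_expansion_fps_of_ratfun:
  assumes "has_expansion f a"
  shows "fps_of_ratfun f = a"
proof -
  obtain p q where pq: "coeff q 0 \<noteq> 0" "f = Fract p q" "a * fps_of_poly q = fps_of_poly p"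
    using assms by (auto simp: has_expansion_def)
  have "fps_of_poly q \<noteq> 0" using pq(1) by (metis fps_of_poly_nth fps_zero_nth)
  then have "fps_of_poly p / fps_of_poly q = a" using pq(3) by (simp flip: pq(3))
  then show ?thesis using fps_of_ratfun_Fract[OF pq(1)] pq(2) by simp
qed

lemma has_expansion_to_fract: "has_expansion (to_fract p) (fps_of_poly p)"
  unfolding has_expansion_def to_fract_def by (intro exI[of _ p] exI[of _ 1]) simp

lemma has_expansion_add:
  assumes "has_expansion f a" "has_expansion g b"
  shows "has_expansion (f + g) (a + b)"
proof -
  obtain p q p' q' where *: "coeff q 0 \<noteq> 0" "f = Fract p q" "a * fps_of_poly q = fps_of_poly p"
    "coeff q' 0 \<noteq> 0" "g = Fract p' q'" "b * fps_of_poly q' = fps_of_poly p'"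
    using assms by (auto simp: has_expansion_def)
  then have "q \<noteq> 0" "q' \<noteq> 0" by auto
  then show ?thesis unfolding has_expansion_def
    using * by (intro exI[of _ "p * q' + p' * q"] exI[of _ "q * q'"])
      (simp add: coeff_mult_0 fps_of_poly_mult fps_of_poly_add algebra_simps flip: *(3,6))
qed

lemma has_expansion_mult:
  assumes "has_expansion f a" "has_expansion g b"
  shows "has_expansion (f * g) (a * b)"
proof -
  obtain p q p' q' where *: "coeff q 0 \<noteq> 0" "f = Fract p q" "a * fps_of_poly q = fps_of_poly p"
    "coeff q' 0 \<noteq> 0" "g = Fract p' q'" "b * fps_of_poly q' = fps_of_poly p'"
    using assms by (auto simp: has_expansion_def)
  then show ?thesis unfolding has_expansion_def
    by (intro exI[of _ "p * p'"] exI[of _ "q * q'"])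
      (simp add: coeff_mult_0 fps_of_poly_mult algebra_simps flip: *(3,6))
qed

lemma has_expansion_of_int: "has_expansion (of_int k) (of_int k)"
proof -
  have "to_fract (of_int k :: rat poly) = of_int k"
    by (cases k rule: int_cases2) (simp_all add: to_fract_def Fract_of_nat_eq flip: minus_fract)
  moreover have "fps_of_poly (of_int k :: rat poly) = of_int k"
    by (simp add: of_int_poly fps_of_poly_const fps_of_int)
  ultimately show ?thesis using has_expansion_to_fract[of "of_int k"] by simp
qed

lemma has_expansion_sum:
  "(\<And>x. x \<in> A \<Longrightarrow> has_expansion (f x) (a x)) \<Longrightarrow> has_expansion (sum f A) (sum a A)"
  using has_expansion_of_int[of 0]
  by (induction A rule: infinite_finite_induct) (auto intro: has_expansion_add)

text \<open>Stated with the product \<open>fps_of_poly p * a\<close> so that no power series has to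
  be inverted; this is the shape that \<open>weight_fps_recursion\<close> provides.\<close>

lemma has_expansion_divide_to_fract:
  assumes "has_expansion f (fps_of_poly p * a)" "coeff p 0 \<noteq> 0"
  shows "has_expansion (1 / to_fract p * f) a"
proof -
  obtain u v where *: "coeff v 0 \<noteq> 0" "f = Fract u v" "fps_of_poly p * a * fps_of_poly v = fps_of_poly u"
    using assms(1) by (auto simp: has_expansion_def)
  then show ?thesis unfolding has_expansion_def using assms(2)
    by (intro exI[of _ u] exI[of _ "p * v"])
      (simp add: coeff_mult_0 fps_of_poly_mult to_fract_def One_fract_def algebra_simps)
qed

lemma has_expansion_top_zeta:
  "matroid M \<Longrightarrow> loopless M \<Longrightarrow> has_expansion (top_zeta M) (weight_fps M)"
proof (induction M rule: top_zeta.induct)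
  case (1 M)
  interpret matroid M by fact
  show ?case
  proof (cases "rk M (ground M) = 0")
    case True
    \<comment> \<open>A loopless matroid of rank 0 has no elements, so the empty sequence is the
      only one and the series is 1.\<close>
    then have empty: "ground M = {}" using rk_pos[OF 1(3)] by force
    have "weight_sum M {} m = (if m = 0 then 1 else 0)" for m
    proof -
      have "{es :: 'a list. es = [] \<and> length es = m} = (if m = 0 then {[]} else {})" by auto
      then show ?thesis by (simp add: weight_sum_def)
    qed
    then have "weight_fps M = 1" by (auto simp: weight_fps_def empty fps_eq_iff)
    then show ?thesis
      using has_expansion_of_int[of 1] True finite_ground by (simp add: top_zeta.simps)
  next
    case False
    define S where "S = (\<Sum>F\<in>flats M - {ground M}. top_zeta (restriction M F) *
        of_int (poly (reduced_characteristic_poly (contraction M F)) 1))"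
    have "has_expansion S (\<Sum>F\<in>flats M - {ground M}. weight_fps (restriction M F) *
        of_int (poly (reduced_characteristic_poly (contraction M F)) 1))"
      unfolding S_def
    proof (intro has_expansion_sum has_expansion_mult has_expansion_of_int 1(1) matroid_restriction)
      fix F assume F: "F \<in> flats M - {ground M}"
      show "F \<subseteq> ground M" using F by (simp add: flats_def)
      then show "loopless (restriction M F)" using 1(3) by (auto simp: loopless_def restriction_def)
    qed (use finite_ground False in auto)
    then have "has_expansion S
        (fps_of_poly [:of_nat (rk M (ground M)), of_nat (card (ground M)):] * weight_fps M)"
      by (simp only: weight_fps_recursion[OF 1(3)])
    then have "has_expansion (1 / to_fract [:of_nat (rk M (ground M)), of_nat (card (ground M)):] * S)
        (weight_fps M)"
      using False by (intro has_expansion_divide_to_fract) simp_all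
    moreover have "top_zeta M = 1 / to_fract [:of_nat (rk M (ground M)), of_nat (card (ground M)):] * S"
      using False finite_ground by (subst top_zeta.simps) (simp add: S_def)
    ultimately show ?thesis by simp
  qed
qed

lemma top_zeta_coeff:
  assumes "matroid M" "loopless M"
  shows "(-1) ^ m * fps_nth (fps_of_ratfun (top_zeta M)) m = weight_sum M (ground M) m"
  using has_expansion_fps_of_ratfun[OF has_expansion_top_zeta[OF assms]]
  by (simp add: weight_fps_def flip: mult.assoc power_mult_distrib)

section \<open>Comparison of ranks and weights along a weak map\<close>

text \<open>A maximum independent subset of \<open>S\<close> extends to a basis of \<open>N\<close>,
  whose preimage under \<open>\<phi>\<close> is a basis of \<open>M\<close>. Hence the preimage of
  the subset is independent in \<open>M\<close>, and it has the same size.\<close>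

lemma weak_map_rk_le:
  assumes "matroid M" "matroid N" "induces_weak_map \<phi> M N" "S \<subseteq> ground N"
  shows "rk N S \<le> rk M (inv_into (ground M) \<phi> ` S)"
proof -
  interpret M: matroid M by fact
  interpret N: matroid N by fact
  let ?\<psi> = "inv_into (ground M) \<phi>"
  have inj: "inj_on ?\<psi> (ground N)"
    using assms(3) by (metis bij_betw_def bij_betw_inv_into induces_weak_map_def)
  obtain I where I: "I \<in> indeps N" "I \<subseteq> S" "card I = rk N S" by (rule N.rk_witness)
  obtain B where B: "B \<in> indeps N" "I \<subseteq> B" "card B = rk N (ground N)"
    using N.indep_extend[OF I(1) N.indep_subset_ground[OF I(1)]] .
  have "basis N B"
    unfolding basis_def
  proof (intro conjI ballI impI)
    fix J assume J: "J \<in> indeps N" "B \<subseteq> J"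
    then show "J = B"
      using N.card_le_rk[OF J(1) N.indep_subset_ground[OF J(1)]] B N.finite_indep card_seteq by metis
  qed fact
  then have "?\<psi> ` B \<in> indeps M" using assms(3) by (simp add: induces_weak_map_def basis_def)
  then have "?\<psi> ` I \<in> indeps M" using M.hereditary B by blast
  then have "card (?\<psi> ` I) \<le> rk M (?\<psi> ` S)" using I by (intro M.card_le_rk) auto
  moreover have "card (?\<psi> ` I) = card I"
    using inj I assms(4) by (intro card_image inj_on_subset[OF inj]) auto
  ultimately show ?thesis using I by simp
qed

text \<open>Each denominator on the \<open>M\<close> side is at least the matching one for
  \<open>N\<close>. Looplessness of \<open>N\<close> keeps the latter positive; a zero denominator
  would make the quotient 0 and spoil the comparison.\<close>

lemma weak_map_seq_weight_le:
  assumes "matroid M" "matroid N" "loopless N" "induces_weak_map \<phi> M N" "set es \<subseteq> ground N"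
  shows "seq_weight M (map (inv_into (ground M) \<phi>) es) \<le> seq_weight N es"
  using assms(5)
proof (induction es)
  case (Cons e es)
  interpret N: matroid N by fact
  let ?\<psi> = "inv_into (ground M) \<phi>"
  have le: "rk N (set (e # es)) \<le> rk M (?\<psi> ` set (e # es))"
    using assms Cons.prems by (intro weak_map_rk_le)
  have "rk N (set (e # es)) > 0" using N.rk_pos[OF assms(3), of e] Cons.prems by simp
  then have "seq_weight M (map ?\<psi> es) / of_nat (rk M (?\<psi> ` set (e # es)))
    \<le> seq_weight N es / of_nat (rk N (set (e # es)))"
    using le Cons by (intro frac_le) (simp_all add: seq_weight_nonneg)
  then show ?case by simp
qed simp

lemma weak_map_weight_sum_le:
  assumes "matroid M" "matroid N" "loopless N" "induces_weak_map \<phi> M N"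
  shows "weight_sum M (ground M) m \<le> weight_sum N (ground N) m"
proof -
  let ?\<psi> = "inv_into (ground M) \<phi>"
  let ?L = "\<lambda>A. {es. set es \<subseteq> A \<and> length es = m}"
  have bij: "bij_betw ?\<psi> (ground N) (ground M)"
    using assms(4) by (simp add: induces_weak_map_def bij_betw_inv_into)
  \<comment> \<open>Every sequence over \<open>ground M\<close> is the image of one over
    \<open>ground N\<close>. As weights are nonnegative, summing over all preimages can then only
    increase the total.\<close>
  have "?L (ground M) \<subseteq> map ?\<psi> ` ?L (ground N)"
  proof
    fix es assume es: "es \<in> ?L (ground M)"
    then have "es \<in> lists (?\<psi> ` ground N)" using bij by (auto simp: bij_betw_def)
    then obtain fs where "es = map ?\<psi> fs" "fs \<in> lists (ground N)" by (auto simp: lists_image)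
    then show "es \<in> map ?\<psi> ` ?L (ground N)" using es by auto
  qed
  then have "weight_sum M (ground M) m \<le> (\<Sum>es\<in>map ?\<psi> ` ?L (ground N). seq_weight M es)"
    unfolding weight_sum_def using assms(2)
    by (intro sum_mono2) (auto simp: seq_weight_nonneg matroid.finite_ground finite_lists_length_eq)
  also have "\<dots> \<le> (\<Sum>es\<in>?L (ground N). seq_weight M (map ?\<psi> es))"
    using sum_image_le[of "?L (ground N)" "seq_weight M" "map ?\<psi>"] assms(2)
    by (simp add: seq_weight_nonneg matroid.finite_ground finite_lists_length_eq)
  also have "\<dots> \<le> weight_sum N (ground N) m"
    unfolding weight_sum_def by (intro sum_mono weak_map_seq_weight_le) (use assms in auto)
  finally show ?thesis .
qed

theorem theorem1p6:
  fixes M N :: "'a indep_system" and E :: "'a set" and \<phi> :: "'a \<Rightarrow> 'a" and m :: nat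
  assumes "matroid M" and "matroid N"
    and "loopless M" and "loopless N"
    and "ground M = E" and "ground N = E"
    and "bij_betw \<phi> E E"
    and "induces_weak_map \<phi> M N"
  shows "(-1) ^ m * fps_nth (fps_of_ratfun (top_zeta N)) m
       \<ge> (-1) ^ m * fps_nth (fps_of_ratfun (top_zeta M)) m"
  using weak_map_weight_sum_le[OF assms(1,2,4,8), of m]
  by (simp only: top_zeta_coeff[OF assms(1,3)] top_zeta_coeff[OF assms(2,4)])

end
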